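(* Let $A$ be an associative algebra, $M$ an $A$-bimodule, $(T_1,T_2)$ a compatible $\mathcal{O}$-operator on $M$ over $A$, and $N\in\mathbb{N}$. An order $N$ deformation $(T^N_{1,t},T^N_{2,t})$ of $(T_1,T_2)$ is extensible if and only if the corresponding obstruction class $[\mathrm{Ob}_{(T^N_{1,t},T^N_{2,t})}]\in H^2_{(T_1,T_2)}(M,A)$ vanishes.
   Context: All vector spaces are over a field $\mathbf{k}$ of characteristic $0$; $\cdot$ denotes the product of $A$ and both actions on $M$. An $\mathcal{O}$-operator on $M$ over $A$ is a linear map $T:M\to A$ with $T(u)\cdot T(v)=T(T(u)\cdot v+u\cdot T(v))$ for all $u,v\in M$. A compatible $\mathcal{O}$-operator is a pair $(T_1,T_2)$ of $\mathcal{O}$-operators such that for all $u,v\in M$ $$T_1(u)\cdot T_2(v)+T_2(u)\cdot T_1(v)=T_1(T_2(u)\cdot v+u\cdot T_2(v))+T_2(T_1(u)\cdot v+u\cdot T_1(v)).$$ Cohomology. For linear $T:M\to A$, $a\in A$, $f\in\mathrm{Hom}(M^{\otimes n},A)$, $n\ge1$, put $$[T,a](u)=T(a\cdot u-u\cdot a)+T(u)\cdot a-a\cdot T(u),$$ $$[T,f](u_1,\ldots,u_{n+1})=T(f(u_1,\ldots,u_n)\cdot u_{n+1})-(-1)^nT(u_1\cdot f(u_2,\ldots,u_{n+1}))$$ $$-(-1)^n\Big\{\sum_{i=1}^n(-1)^{i-1}f(u_1,\ldots,u_{i-1},T(u_i)\cdot u_{i+1},u_{i+2},\ldots,u_{n+1})-\sum_{i=1}^n(-1)^if(u_1,\ldots,u_{i-1},u_i\cdot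 T(u_{i+1}),u_{i+2},\ldots,u_{n+1})\Big\}$$ $$+(-1)^n\big\{T(u_1)\cdot f(u_2,\ldots,u_{n+1})-(-1)^nf(u_1,\ldots,u_n)\cdot T(u_{n+1})\big\}.$$ Let $C^0_{\mathrm{cO}}(M,A)=A$ and, for $n\ge1$, $C^n_{\mathrm{cO}}(M,A)$ be the direct sum of $n+1$ copies of $\mathrm{Hom}(M^{\otimes n},A)$, with differential $\delta_{(T_1,T_2)}(a)=([T_1,a],[T_2,a])$ and $$\delta_{(T_1,T_2)}((f_1,\ldots,f_{n+1}))=\big([T_1,f_1],\ldots,\underbrace{[T_1,f_i]+[T_2,f_{i-1}]}_{i\text{-th place}},\ldots,[T_2,f_{n+1}]\big).$$ The cohomology groups are $H^\bullet_{(T_1,T_2)}(M,A)$. For $(x_1,x_2),(y_1,y_2)\in C^1_{\mathrm{cO}}(M,A)$ put $$\llbracket(x_1,x_2),(y_1,y_2)\rrbracket=\big([x_1,y_1],\,[x_1,y_2]+[x_2,y_1],\,[x_2,y_2]\big)\in C^2_{\mathrm{cO}}(M,A),$$ where for $P,Q\in\mathrm{Hom}(M,A)$ the bracket $[P,Q]\in\mathrm{Hom}(M^{\otimes 2},A)$ (that is, $[T,f]$ with $T=P$, $f=Q$ and $n=1$) is given by $[P,Q](u,v)=P(Q(u)\cdot v+u\cdot Q(v))+Q(P(u)\cdot v+u\cdot P(v))-P(u)\cdot Q(v)-Q(u)\cdot P(v)$. Deformations. An order $N$ deformation of $(T_1,T_2)$ is a pair of polynomials $T^N_{1,t}=\sum_{i=0}^Nt^iT_{1,i}$,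 $T^N_{2,t}=\sum_{i=0}^Nt^iT_{2,i}$ with $T_{1,i},T_{2,i}\in\mathrm{Hom}(M,A)$, $T_{1,0}=T_1$, $T_{2,0}=T_2$, such that for $n=0,1,\ldots,N$ and all $u,v\in M$ $$\sum_{i+j=n}T_{s,i}(u)\cdot T_{s,j}(v)=\sum_{i+j=n}T_{s,i}(T_{s,j}(u)\cdot v+u\cdot T_{s,j}(v)),\quad s=1,2,$$ $$\sum_{i+j=n}\big(T_{1,i}(u)\cdot T_{2,j}(v)+T_{2,i}(u)\cdot T_{1,j}(v)\big)=\sum_{i+j=n}\big(T_{1,i}(T_{2,j}(u)\cdot v+u\cdot T_{2,j}(v))+T_{2,i}(T_{1,j}(u)\cdot v+u\cdot T_{1,j}(v))\big).$$ It is extensible if there exist linear maps $T_{1,N+1},T_{2,N+1}:M\to A$ such that $(T^N_{1,t}+t^{N+1}T_{1,N+1},\ T^N_{2,t}+t^{N+1}T_{2,N+1})$ is an order $N+1$ deformation. Set $$\mathrm{Ob}_{(T^N_{1,t},T^N_{2,t})}=-\frac12\sum_{\substack{i+j=N+1\\ i,j\ge1}}\llbracket(T_{1,i},T_{2,i}),(T_{1,j},T_{2,j})\rrbracket\in C^2_{\mathrm{cO}}(M,A).$$ This is a $2$-cocycle for $\delta_{(T_1,T_2)}$; its class $[\mathrm{Ob}_{(T^N_{1,t},T^N_{2,t})}]$ is the obstruction class. *)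

theory Defs
  imports
    "HOL-Library.Function_Algebras"
    "HOL-Computational_Algebra.Polynomial"
begin

text \<open>
  The algebra is a (not necessarily unital) ring type with a scalar multiplication \<open>sA\<close>;
  the module is an abelian group type with a scalar multiplication \<open>sM\<close>, left action \<open>l\<close>
  and right action \<open>r\<close>. Addition, zero and sums of maps and of cochains are the pointwise
  ones of \<^theory>\<open>HOL-Library.Function_Algebras\<close>.
\<close>

locale assoc_algebra = vector_space sA
  for sA :: "'k::field_char_0 \<Rightarrow> 'a::ring \<Rightarrow> 'a" +
  assumes scale_mult_left: "sA c x * y = sA c (x * y)"
    and scale_mult_right: "x * sA c y = sA c (x * y)"

locale algebra_bimodule = A: assoc_algebra sA + M: vector_space sM
  for sA :: "'k::field_char_0 \<Rightarrow> 'a::ring \<Rightarrow> 'a"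
    and sM :: "'k \<Rightarrow> 'm::ab_group_add \<Rightarrow> 'm" +
  fixes l :: "'a \<Rightarrow> 'm \<Rightarrow> 'm" and r :: "'m \<Rightarrow> 'a \<Rightarrow> 'm"
  assumes left_linear1: "Vector_Spaces.linear sA sM (\<lambda>a. l a u)"
    and left_linear2: "Vector_Spaces.linear sM sM (\<lambda>u. l a u)"
    and right_linear1: "Vector_Spaces.linear sM sM (\<lambda>u. r u a)"
    and right_linear2: "Vector_Spaces.linear sA sM (\<lambda>a. r u a)"
    and left_assoc: "l (a * b) u = l a (l b u)"
    and right_assoc: "r u (a * b) = r (r u a) b"
    and left_right_assoc: "r (l a u) b = l a (r u b)"

definition O_operator ::
  "('k::field_char_0 \<Rightarrow> 'a::ring \<Rightarrow> 'a) \<Rightarrow> ('k \<Rightarrow> 'm::ab_group_add \<Rightarrow> 'm) \<Rightarrow>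
   ('a \<Rightarrow> 'm \<Rightarrow> 'm) \<Rightarrow> ('m \<Rightarrow> 'a \<Rightarrow> 'm) \<Rightarrow> ('m \<Rightarrow> 'a) \<Rightarrow> bool" where
  "O_operator sA sM l r T \<longleftrightarrow>
     Vector_Spaces.linear sM sA T \<and>
     (\<forall>u v. T u * T v = T (l (T u) v + r u (T v)))"

definition compatible_O_operator ::
  "('k::field_char_0 \<Rightarrow> 'a::ring \<Rightarrow> 'a) \<Rightarrow> ('k \<Rightarrow> 'm::ab_group_add \<Rightarrow> 'm) \<Rightarrow>
   ('a \<Rightarrow> 'm \<Rightarrow> 'm) \<Rightarrow> ('m \<Rightarrow> 'a \<Rightarrow> 'm) \<Rightarrow> ('m \<Rightarrow> 'a) \<Rightarrow> ('m \<Rightarrow> 'a) \<Rightarrow> bool" where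
  "compatible_O_operator sA sM l r T1 T2 \<longleftrightarrow>
     O_operator sA sM l r T1 \<and> O_operator sA sM l r T2 \<and>
     (\<forall>u v. T1 u * T2 v + T2 u * T1 v =
       T1 (l (T2 u) v + r u (T2 v)) + T2 (l (T1 u) v + r u (T1 v)))"

text \<open>
  \<open>Hom(M\<^sup>\<otimes>\<^sup>n, A)\<close> is the space of \<open>n\<close>-linear maps, taken as functions on argument lists that are
  zero on lists of length other than \<open>n\<close>. For \<open>n = 0\<close> such a function is determined by its
  arbitrary value on \<open>[]\<close>, so that the space is \<open>A\<close> itself.
\<close>

definition multilinear_maps ::
  "('k::field_char_0 \<Rightarrow> 'a::ring \<Rightarrow> 'a) \<Rightarrow> ('k \<Rightarrow> 'm::ab_group_add \<Rightarrow> 'm) \<Rightarrow> nat \<Rightarrow>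
   ('m list \<Rightarrow> 'a) set" where
  "multilinear_maps sA sM n =
     {f. (\<forall>us. length us \<noteq> n \<longrightarrow> f us = 0) \<and>
         (\<forall>us. length us = n \<longrightarrow>
            (\<forall>i<n. Vector_Spaces.linear sM sA (\<lambda>x. f (us[i := x]))))}"

text \<open>
  The bracket \<open>[T, f]\<close> for \<open>f\<close> of degree \<open>n\<close>. The argument \<open>u\<^sub>i\<close> is \<open>us ! (i - 1)\<close>.
  For \<open>n = 0\<close> and \<open>f [] = a\<close> the formula is the one for \<open>[T, a]\<close>
  (see \<open>bracket_0\<close> below).
\<close>

definition bracket ::
  "('k::field_char_0 \<Rightarrow> 'a::ring \<Rightarrow> 'a) \<Rightarrow> ('a \<Rightarrow> 'm::ab_group_add \<Rightarrow> 'm) \<Rightarrow> ('m \<Rightarrow> 'a \<Rightarrow> 'm) \<Rightarrow>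
   nat \<Rightarrow> ('m \<Rightarrow> 'a) \<Rightarrow> ('m list \<Rightarrow> 'a) \<Rightarrow> 'm list \<Rightarrow> 'a" where
  "bracket sA l r n T f us =
    (if length us = n + 1 then
       T (l (f (take n us)) (us ! n)) - sA ((-1) ^ n) (T (r (us ! 0) (f (drop 1 us))))
       - sA ((-1) ^ n)
           ((\<Sum>i = 1..n. sA ((-1) ^ (i - 1))
               (f (take (i - 1) us @ [l (T (us ! (i - 1))) (us ! i)] @ drop (i + 1) us)))
          - (\<Sum>i = 1..n. sA ((-1) ^ i)
               (f (take (i - 1) us @ [r (us ! (i - 1)) (T (us ! i))] @ drop (i + 1) us))))
       + sA ((-1) ^ n)
           (T (us ! 0) * f (drop 1 us) - sA ((-1) ^ n) (f (take n us) * T (us ! n)))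
     else 0)"

text \<open>
  An \<open>n\<close>-cochain is the family \<open>(F 1, \<dots>, F (n + 1))\<close>, extended by zero to all indices.
  For \<open>n = 0\<close> this is one copy of \<open>A\<close>.
\<close>

definition cochains ::
  "('k::field_char_0 \<Rightarrow> 'a::ring \<Rightarrow> 'a) \<Rightarrow> ('k \<Rightarrow> 'm::ab_group_add \<Rightarrow> 'm) \<Rightarrow> nat \<Rightarrow>
   (nat \<Rightarrow> 'm list \<Rightarrow> 'a) set" where
  "cochains sA sM n =
     {F. (\<forall>i\<in>{1..n + 1}. F i \<in> multilinear_maps sA sM n) \<and> (\<forall>i. i \<notin> {1..n + 1} \<longrightarrow> F i = 0)}"

text \<open>
  In the first place \<open>F (i - 1) = F 0 = 0\<close> and in the last place \<open>F i = F (n + 2) = 0\<close>,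
  so that these places are \<open>[T1, F 1]\<close> and \<open>[T2, F (n + 1)]\<close>.
\<close>

definition differential ::
  "('k::field_char_0 \<Rightarrow> 'a::ring \<Rightarrow> 'a) \<Rightarrow> ('a \<Rightarrow> 'm::ab_group_add \<Rightarrow> 'm) \<Rightarrow> ('m \<Rightarrow> 'a \<Rightarrow> 'm) \<Rightarrow>
   ('m \<Rightarrow> 'a) \<Rightarrow> ('m \<Rightarrow> 'a) \<Rightarrow> nat \<Rightarrow> (nat \<Rightarrow> 'm list \<Rightarrow> 'a) \<Rightarrow> nat \<Rightarrow> 'm list \<Rightarrow> 'a" where
  "differential sA l r T1 T2 n F i =
     (if i \<in> {1..n + 2} then bracket sA l r n T1 (F i) + bracket sA l r n T2 (F (i - 1)) else 0)"

definition cocycles ::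
  "('k::field_char_0 \<Rightarrow> 'a::ring \<Rightarrow> 'a) \<Rightarrow> ('k \<Rightarrow> 'm::ab_group_add \<Rightarrow> 'm) \<Rightarrow>
   ('a \<Rightarrow> 'm \<Rightarrow> 'm) \<Rightarrow> ('m \<Rightarrow> 'a \<Rightarrow> 'm) \<Rightarrow> ('m \<Rightarrow> 'a) \<Rightarrow> ('m \<Rightarrow> 'a) \<Rightarrow> nat \<Rightarrow>
   (nat \<Rightarrow> 'm list \<Rightarrow> 'a) set" where
  "cocycles sA sM l r T1 T2 n = {F \<in> cochains sA sM n. differential sA l r T1 T2 n F = 0}"

definition coboundaries ::
  "('k::field_char_0 \<Rightarrow> 'a::ring \<Rightarrow> 'a) \<Rightarrow> ('k \<Rightarrow> 'm::ab_group_add \<Rightarrow> 'm) \<Rightarrow>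
   ('a \<Rightarrow> 'm \<Rightarrow> 'm) \<Rightarrow> ('m \<Rightarrow> 'a \<Rightarrow> 'm) \<Rightarrow> ('m \<Rightarrow> 'a) \<Rightarrow> ('m \<Rightarrow> 'a) \<Rightarrow> nat \<Rightarrow>
   (nat \<Rightarrow> 'm list \<Rightarrow> 'a) set" where
  "coboundaries sA sM l r T1 T2 n =
     (if n = 0 then {0} else differential sA l r T1 T2 (n - 1) ` cochains sA sM (n - 1))"

definition cohomologous ::
  "('k::field_char_0 \<Rightarrow> 'a::ring \<Rightarrow> 'a) \<Rightarrow> ('k \<Rightarrow> 'm::ab_group_add \<Rightarrow> 'm) \<Rightarrow>
   ('a \<Rightarrow> 'm \<Rightarrow> 'm) \<Rightarrow> ('m \<Rightarrow> 'a \<Rightarrow> 'm) \<Rightarrow> ('m \<Rightarrow> 'a) \<Rightarrow> ('m \<Rightarrow> 'a) \<Rightarrow> nat \<Rightarrow>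
   (nat \<Rightarrow> 'm list \<Rightarrow> 'a) rel" where
  "cohomologous sA sM l r T1 T2 n =
     {(F, G). F \<in> cocycles sA sM l r T1 T2 n \<and> G \<in> cocycles sA sM l r T1 T2 n \<and>
              F - G \<in> coboundaries sA sM l r T1 T2 n}"

definition cohomology ::
  "('k::field_char_0 \<Rightarrow> 'a::ring \<Rightarrow> 'a) \<Rightarrow> ('k \<Rightarrow> 'm::ab_group_add \<Rightarrow> 'm) \<Rightarrow>
   ('a \<Rightarrow> 'm \<Rightarrow> 'm) \<Rightarrow> ('m \<Rightarrow> 'a \<Rightarrow> 'm) \<Rightarrow> ('m \<Rightarrow> 'a) \<Rightarrow> ('m \<Rightarrow> 'a) \<Rightarrow> nat \<Rightarrow>
   (nat \<Rightarrow> 'm list \<Rightarrow> 'a) set set" where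
  "cohomology sA sM l r T1 T2 n =
     cocycles sA sM l r T1 T2 n // cohomologous sA sM l r T1 T2 n"

definition cohomology_class ::
  "('k::field_char_0 \<Rightarrow> 'a::ring \<Rightarrow> 'a) \<Rightarrow> ('k \<Rightarrow> 'm::ab_group_add \<Rightarrow> 'm) \<Rightarrow>
   ('a \<Rightarrow> 'm \<Rightarrow> 'm) \<Rightarrow> ('m \<Rightarrow> 'a \<Rightarrow> 'm) \<Rightarrow> ('m \<Rightarrow> 'a) \<Rightarrow> ('m \<Rightarrow> 'a) \<Rightarrow> nat \<Rightarrow>
   (nat \<Rightarrow> 'm list \<Rightarrow> 'a) \<Rightarrow> (nat \<Rightarrow> 'm list \<Rightarrow> 'a) set" where
  "cohomology_class sA sM l r T1 T2 n F = cohomologous sA sM l r T1 T2 n `` {F}"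

text \<open>The bracket \<open>[P, Q]\<close> of two maps in \<open>Hom(M, A)\<close>, as an element of \<open>Hom(M \<otimes> M, A)\<close>.\<close>

definition hom_bracket ::
  "('a::ring \<Rightarrow> 'm::ab_group_add \<Rightarrow> 'm) \<Rightarrow> ('m \<Rightarrow> 'a \<Rightarrow> 'm) \<Rightarrow>
   ('m \<Rightarrow> 'a) \<Rightarrow> ('m \<Rightarrow> 'a) \<Rightarrow> 'm list \<Rightarrow> 'a" where
  "hom_bracket l r P Q us =
     (case us of
        [u, v] \<Rightarrow> P (l (Q u) v + r u (Q v)) + Q (l (P u) v + r u (P v)) - P u * Q v - Q u * P v
      | _ \<Rightarrow> 0)"

definition double_bracket ::
  "('a::ring \<Rightarrow> 'm::ab_group_add \<Rightarrow> 'm) \<Rightarrow> ('m \<Rightarrow> 'a \<Rightarrow> 'm) \<Rightarrow>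
   ('m \<Rightarrow> 'a) \<times> ('m \<Rightarrow> 'a) \<Rightarrow> ('m \<Rightarrow> 'a) \<times> ('m \<Rightarrow> 'a) \<Rightarrow> nat \<Rightarrow> 'm list \<Rightarrow> 'a" where
  "double_bracket l r x y i =
     (if i = 1 then hom_bracket l r (fst x) (fst y)
      else if i = 2 then hom_bracket l r (fst x) (snd y) + hom_bracket l r (snd x) (fst y)
      else if i = 3 then hom_bracket l r (snd x) (snd y)
      else 0)"

text \<open>The polynomials \<open>p\<close>, \<open>q\<close> have coefficients in \<open>Hom(M, A)\<close>.\<close>

definition deformation ::
  "('k::field_char_0 \<Rightarrow> 'a::ring \<Rightarrow> 'a) \<Rightarrow> ('k \<Rightarrow> 'm::ab_group_add \<Rightarrow> 'm) \<Rightarrow>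
   ('a \<Rightarrow> 'm \<Rightarrow> 'm) \<Rightarrow> ('m \<Rightarrow> 'a \<Rightarrow> 'm) \<Rightarrow> ('m \<Rightarrow> 'a) \<Rightarrow> ('m \<Rightarrow> 'a) \<Rightarrow> nat \<Rightarrow>
   ('m \<Rightarrow> 'a) poly \<Rightarrow> ('m \<Rightarrow> 'a) poly \<Rightarrow> bool" where
  "deformation sA sM l r T1 T2 N p q \<longleftrightarrow>
     degree p \<le> N \<and> degree q \<le> N \<and>
     (\<forall>i. Vector_Spaces.linear sM sA (coeff p i)) \<and>
     (\<forall>i. Vector_Spaces.linear sM sA (coeff q i)) \<and>
     coeff p 0 = T1 \<and> coeff q 0 = T2 \<and>
     (\<forall>n\<le>N. \<forall>u v.
        (\<forall>S\<in>{p, q}.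
           (\<Sum>(i, j)\<in>{(i, j). i + j = n}. coeff S i u * coeff S j v) =
           (\<Sum>(i, j)\<in>{(i, j). i + j = n}. coeff S i (l (coeff S j u) v + r u (coeff S j v)))) \<and>
        (\<Sum>(i, j)\<in>{(i, j). i + j = n}. coeff p i u * coeff q j v + coeff q i u * coeff p j v) =
        (\<Sum>(i, j)\<in>{(i, j). i + j = n}.
           coeff p i (l (coeff q j u) v + r u (coeff q j v)) +
           coeff q i (l (coeff p j u) v + r u (coeff p j v))))"

definition extensible ::
  "('k::field_char_0 \<Rightarrow> 'a::ring \<Rightarrow> 'a) \<Rightarrow> ('k \<Rightarrow> 'm::ab_group_add \<Rightarrow> 'm) \<Rightarrow>
   ('a \<Rightarrow> 'm \<Rightarrow> 'm) \<Rightarrow> ('m \<Rightarrow> 'a \<Rightarrow> 'm) \<Rightarrow> ('m \<Rightarrow> 'a) \<Rightarrow> ('m \<Rightarrow> 'a) \<Rightarrow> nat \<Rightarrow>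
   ('m \<Rightarrow> 'a) poly \<Rightarrow> ('m \<Rightarrow> 'a) poly \<Rightarrow> bool" where
  "extensible sA sM l r T1 T2 N p q \<longleftrightarrow>
     (\<exists>X Y. Vector_Spaces.linear sM sA X \<and> Vector_Spaces.linear sM sA Y \<and>
        deformation sA sM l r T1 T2 (N + 1) (p + monom X (N + 1)) (q + monom Y (N + 1)))"

definition obstruction ::
  "('k::field_char_0 \<Rightarrow> 'a::ring \<Rightarrow> 'a) \<Rightarrow> ('a \<Rightarrow> 'm::ab_group_add \<Rightarrow> 'm) \<Rightarrow> ('m \<Rightarrow> 'a \<Rightarrow> 'm) \<Rightarrow>
   nat \<Rightarrow> ('m \<Rightarrow> 'a) poly \<Rightarrow> ('m \<Rightarrow> 'a) poly \<Rightarrow> nat \<Rightarrow> 'm list \<Rightarrow> 'a" where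
  "obstruction sA l r N p q k us =
     sA (- (1 / 2))
       (\<Sum>(i, j)\<in>{(i, j). i + j = N + 1 \<and> 1 \<le> i \<and> 1 \<le> j}.
          double_bracket l r (coeff p i, coeff q i) (coeff p j, coeff q j) k us)"

text \<open>The general bracket specialises to the formulas in degrees 0 and 1.\<close>

lemma bracket_0:
  assumes "algebra_bimodule sA sM l r" "Vector_Spaces.linear sM sA T" "f [] = a"
  shows "bracket sA l r 0 T f [u] = T (l a u - r u a) + T u * a - a * T u"
proof -
  interpret algebra_bimodule sA sM l r by fact
  interpret T: Vector_Spaces.linear sM sA T by fact
  show ?thesis using assms(3) by (simp add: bracket_def T.diff)
qed

lemma bracket_1:
  assumes "algebra_bimodule sA sM l r" "Vector_Spaces.linear sM sA P"
    "Vector_Spaces.linear sM sA Q"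
  shows "bracket sA l r 1 P (\<lambda>us. case us of [u] \<Rightarrow> Q u | _ \<Rightarrow> 0) = hom_bracket l r P Q"
proof
  interpret algebra_bimodule sA sM l r by fact
  interpret P: Vector_Spaces.linear sM sA P by fact
  interpret Q: Vector_Spaces.linear sM sA Q by fact
  fix us :: "'c list"
  show "bracket sA l r 1 P (\<lambda>us. case us of [u] \<Rightarrow> Q u | _ \<Rightarrow> 0) us = hom_bracket l r P Q us"
    by (auto simp: bracket_def hom_bracket_def P.add Q.add algebra_simps
        split: list.splits)
qed

end

theory Submission imports Defs begin

text \<open>
  A deformation is governed by one generating identity. For sequences \<open>x\<close>, \<open>y\<close> of linear maps put
  \<open>(x * y) n = \<Sum>\<^bsub>i+j=n\<^esub> [x i, y j]\<close>. Since \<open>[P, Q]\<close> is symmetric on \<open>Hom(M, A)\<close> and \<open>2\<close> is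
  invertible, the deformation equations in degree \<open>n\<close> say that \<open>p * p\<close>, \<open>p * q\<close> and \<open>q * q\<close>
  vanish at \<open>n\<close> (lemma \<open>deformation_iff\<close>).

  As \<open>p\<close> and \<open>q\<close> have degree at most \<open>N\<close>, their coefficients at \<open>N + 1\<close> are zero, so the obstruction
  loses nothing if its sum is taken over all \<open>i + j = N + 1\<close>: its components are \<open>-1/2 (p * p)\<close>,
  \<open>-(p * q)\<close> and \<open>-1/2 (q * q)\<close>, taken at \<open>N + 1\<close>. Adding terms with coefficients \<open>X\<close> and \<open>Y\<close> in
  degree \<open>N + 1\<close> leaves the equations of degree at most \<open>N\<close> alone and changes \<open>p * p\<close>, \<open>p * q\<close> and
  \<open>q * q\<close> at \<open>N + 1\<close> by \<open>2 [T1, X]\<close>, \<open>[T1, Y] + [T2, X]\<close> and \<open>2 [T2, Y]\<close> (lemma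
  \<open>conv_bracket_extend\<close>). So the three equations of degree \<open>N + 1\<close> say that the obstruction is
  \<open>([T1, X], [T1, Y] + [T2, X], [T2, Y])\<close>, which is the differential of \<open>(X, Y)\<close>.

  That the obstruction is a cocycle, so that it has a class at all, rests on the Jacobi identity
  \<open>[P, [Q, R]] + [Q, [R, P]] + [R, [P, Q]] = 0\<close>. Summed over \<open>i + j + k = N + 1\<close> it gives
  \<open>\<Sum>\<^sub>i [x i, (y * z) (N + 1 - i)] + cyclic = 0\<close>, and if the deformation equations hold up to \<open>N\<close>
  only the terms with \<open>i = 0\<close> are left. Taking \<open>x\<close>, \<open>y\<close>, \<open>z\<close> from \<open>p\<close> and \<open>q\<close> yields the four
  components of the cocycle condition (lemmas \<open>conv_bracket_cyclic_sum\<close> and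
  \<open>obstruction_cocycle\<close>).
\<close>

section \<open>Sums over pairs and triples of given total\<close>

lemma sum_fun_eval: "(\<Sum>a\<in>A. f a) x = (\<Sum>a\<in>A. f a x)"
  by (induction A rule: infinite_finite_induct) auto

lemma finite_antidiagonal: "finite {(i, j). i + j = (n::nat)}"
  by (rule finite_subset[of _ "{..n} \<times> {..n}"]) auto

lemma antidiagonal_sum_swap:
  "(\<Sum>(i, j)\<in>{(i, j). i + j = (n::nat)}. f i j) = (\<Sum>(i, j)\<in>{(i, j). i + j = n}. f j i)"
  by (rule sum.reindex_bij_witness[of _ prod.swap prod.swap]) auto

lemma antidiagonal_sum_nested:
  "(\<Sum>(i, m)\<in>{(i, m). i + m = (n::nat)}. \<Sum>(j, k)\<in>{(j, k). j + k = m}. f i j k) =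
   (\<Sum>(i, j, k)\<in>{(i, j, k). i + j + k = n}. f i j k)"
proof -
  have "(\<Sum>(i, m)\<in>{(i, m). i + m = n}. \<Sum>(j, k)\<in>{(j, k). j + k = m}. f i j k) =
    (\<Sum>((i, m), (j, k))\<in>Sigma {(i, m). i + m = n} (\<lambda>(i, m). {(j, k). j + k = m}). f i j k)"
    by (subst sum.Sigma[symmetric]) (auto simp: finite_antidiagonal case_prod_beta)
  also have "\<dots> = (\<Sum>(i, j, k)\<in>{(i, j, k). i + j + k = n}. f i j k)"
    by (rule sum.reindex_bij_witness[of _ "\<lambda>(i, j, k). ((i, j + k), (j, k))"
          "\<lambda>((i, m), (j, k)). (i, j, k)"]) auto
  finally show ?thesis .
qed

lemma triple_sum_rotate:
  "(\<Sum>(i, j, k)\<in>{(i, j, k). i + j + k = (n::nat)}. f i j k) =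
   (\<Sum>(i, j, k)\<in>{(i, j, k). i + j + k = n}. f j k i)"
  by (rule sum.reindex_bij_witness[of _ "\<lambda>(i, j, k). (j, k, i)" "\<lambda>(i, j, k). (k, i, j)"]) auto

section \<open>The Cauchy product formed with the bracket\<close>

text \<open>
  The coefficient of \<open>t\<^sup>n\<close> in the bracket \<open>[x, y]\<close> of the formal power series with coefficients
  \<open>x i\<close> and \<open>y j\<close>.
\<close>

definition conv_bracket ::
  "('a::ring \<Rightarrow> 'm::ab_group_add \<Rightarrow> 'm) \<Rightarrow> ('m \<Rightarrow> 'a \<Rightarrow> 'm) \<Rightarrow>
   (nat \<Rightarrow> 'm \<Rightarrow> 'a) \<Rightarrow> (nat \<Rightarrow> 'm \<Rightarrow> 'a) \<Rightarrow> nat \<Rightarrow> 'm list \<Rightarrow> 'a" where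
  "conv_bracket l r x y n = (\<Sum>(i, j)\<in>{(i, j). i + j = n}. hom_bracket l r (x i) (y j))"

definition hom_cochain :: "('m \<Rightarrow> 'a::zero) \<Rightarrow> 'm list \<Rightarrow> 'a" where
  "hom_cochain X us = (case us of [u] \<Rightarrow> X u | _ \<Rightarrow> 0)"

lemma hom_bracket_commute: "hom_bracket l r P Q = hom_bracket l r Q P"
  by (rule ext) (auto simp: hom_bracket_def algebra_simps split: list.splits)

lemma hom_bracket_eq_0_if_length: "length us \<noteq> 2 \<Longrightarrow> hom_bracket l r P Q us = 0"
  by (auto simp: hom_bracket_def split: list.splits)

lemma conv_bracket_commute: "conv_bracket l r x y n = conv_bracket l r y x n"
  unfolding conv_bracket_def
  by (subst antidiagonal_sum_swap) (simp add: hom_bracket_commute)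

lemma conv_bracket_eq_0_if_length: "length us \<noteq> 2 \<Longrightarrow> conv_bracket l r x y n us = 0"
  by (simp add: conv_bracket_def sum_fun_eval hom_bracket_eq_0_if_length case_prod_beta)

text \<open>
  The right-hand side is the compatibility equation of degree \<open>n\<close>. It pairs \<open>x i\<close> with \<open>y j\<close> and
  \<open>y i\<close> with \<open>x j\<close>, whereas each bracket has both kinds of terms for one pair \<open>(x i, y j)\<close>; exchanging
  \<open>i\<close> and \<open>j\<close> in half of the terms matches the two.
\<close>

lemma conv_bracket_eq_0_iff:
  "conv_bracket l r x y n = 0 \<longleftrightarrow>
    (\<forall>u v. (\<Sum>(i, j)\<in>{(i, j). i + j = n}. x i u * y j v + y i u * x j v) =
      (\<Sum>(i, j)\<in>{(i, j). i + j = n}.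
         x i (l (y j u) v + r u (y j v)) + y i (l (x j u) v + r u (x j v))))"
proof -
  have *: "conv_bracket l r x y n [u, v] =
      (\<Sum>(i, j)\<in>{(i, j). i + j = n}.
         x i (l (y j u) v + r u (y j v)) + y i (l (x j u) v + r u (x j v))) -
      (\<Sum>(i, j)\<in>{(i, j). i + j = n}. x i u * y j v + y i u * x j v)" for u v
  proof -
    have "(\<Sum>(i, j)\<in>{(i, j). i + j = n}. y i (l (x j u) v + r u (x j v))) =
        (\<Sum>(i, j)\<in>{(i, j). i + j = n}. y j (l (x i u) v + r u (x i v)))"
      and "(\<Sum>(i, j)\<in>{(i, j). i + j = n}. y i u * x j v) =
        (\<Sum>(i, j)\<in>{(i, j). i + j = n}. y j u * x i v)"
      by (rule antidiagonal_sum_swap)+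
    note swap = this
    have "conv_bracket l r x y n [u, v] =
        (\<Sum>(i, j)\<in>{(i, j). i + j = n}. x i (l (y j u) v + r u (y j v))) +
        (\<Sum>(i, j)\<in>{(i, j). i + j = n}. y j (l (x i u) v + r u (x i v))) -
        (\<Sum>(i, j)\<in>{(i, j). i + j = n}. x i u * y j v) -
        (\<Sum>(i, j)\<in>{(i, j). i + j = n}. y j u * x i v)"
      unfolding conv_bracket_def sum_fun_eval sum.distrib[symmetric] sum_subtractf[symmetric]
      by (rule sum.cong) (auto simp: hom_bracket_def)
    also have "\<dots> = 
        ((\<Sum>(i, j)\<in>{(i, j). i + j = n}. x i (l (y j u) v + r u (y j v))) +
        (\<Sum>(i, j)\<in>{(i, j). i + j = n}. y i (l (x j u) v + r u (x j v)))) -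
        ((\<Sum>(i, j)\<in>{(i, j). i + j = n}. x i u * y j v) +
        (\<Sum>(i, j)\<in>{(i, j). i + j = n}. y i u * x j v))"
      unfolding swap by (rule diff_diff_add)
    finally show ?thesis
      unfolding sum.distrib[symmetric] by (simp only: case_prod_unfold)
  qed
  show ?thesis (is "_ \<longleftrightarrow> ?R")
  proof
    assume "conv_bracket l r x y n = 0"
    then have "conv_bracket l r x y n [u, v] = 0" for u v by simp
    then show ?R unfolding * by simp
  next
    assume R: ?R
    show "conv_bracket l r x y n = 0"
    proof
      fix us
      show "conv_bracket l r x y n us = 0 us"
      proof (cases "length us = 2")
        case True
        then obtain u v where "us = [u, v]" by (auto simp: length_Suc_conv numeral_2_eq_2)
        then show ?thesis using R by (simp only: * zero_fun_apply diff_self)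
      qed (simp add: conv_bracket_eq_0_if_length)
    qed
  qed
qed

section \<open>The bracket on multilinear maps and its Jacobi identity\<close>

context algebra_bimodule
begin

interpretation L1: Vector_Spaces.linear sA sM "\<lambda>a. l a u" for u by (rule left_linear1)
interpretation L2: Vector_Spaces.linear sM sM "\<lambda>u. l a u" for a by (rule left_linear2)
interpretation R1: Vector_Spaces.linear sM sM "\<lambda>u. r u a" for a by (rule right_linear1)
interpretation R2: Vector_Spaces.linear sA sM "\<lambda>a. r u a" for u by (rule right_linear2)

abbreviation "lin \<equiv> Vector_Spaces.linear sM sA"
abbreviation "br \<equiv> bracket sA l r"
abbreviation "hb \<equiv> hom_bracket l r"
abbreviation "cb \<equiv> conv_bracket l r"

lemma add_self_eq_iff: "(a::'a) + a = b + b \<longleftrightarrow> a = b"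
proof -
  have "sA 2 c = c + c" for c by (metis A.scale_left_distrib A.scale_one one_add_one)
  then show ?thesis by (metis A.scale_cancel_left zero_neq_numeral)
qed

lemma bracket_2: "br 2 T f [u, v, w] =
    T (l (f [u, v]) w) - T (r u (f [v, w]))
    - (f [l (T u) v, w] - f [u, l (T v) w] + f [r u (T v), w] - f [u, r v (T w)])
    + T u * f [v, w] - f [u, v] * T w"
proof -
  have "{1..2::nat} = {1,2}" by auto
  then show ?thesis by (simp add: bracket_def numeral_2_eq_2)
qed

text \<open>
  After expansion by linearity, associativity of \<open>A\<close> and the bimodule axioms bring every term
  to a normal form, in which all terms cancel in pairs.
\<close>

lemma hom_bracket_jacobi:
  assumes "lin P" "lin Q" "lin R"
  shows "br 2 P (hb Q R) + br 2 Q (hb R P) + br 2 R (hb P Q) = 0"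
proof
  interpret P: Vector_Spaces.linear sM sA P by fact
  interpret Q: Vector_Spaces.linear sM sA Q by fact
  interpret R: Vector_Spaces.linear sM sA R by fact
  fix us
  show "(br 2 P (hb Q R) + br 2 Q (hb R P) + br 2 R (hb P Q)) us = 0 us"
  proof (cases "length us = 3")
    case True
    then obtain u v w where us: "us = [u, v, w]" by (auto simp: length_Suc_conv numeral_3_eq_3)
    show ?thesis unfolding us
      by (simp add: bracket_2 hom_bracket_def P.add Q.add R.add P.diff Q.diff R.diff
          L1.add L2.add R1.add R2.add L1.diff L2.diff R1.diff R2.diff
          left_assoc right_assoc left_right_assoc algebra_simps)
  qed (simp add: bracket_def)
qed

lemma additive_bracket:
  assumes "lin T"
  shows "additive (br n T)"
proof
  interpret T: Vector_Spaces.linear sM sA T by fact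
  fix f g :: "'m list \<Rightarrow> 'a"
  show "br n T (f + g) = br n T f + br n T g"
    by (rule ext) (simp add: bracket_def T.add L1.add R2.add sum.distrib
        A.scale_right_distrib A.scale_right_diff_distrib algebra_simps)
qed

lemma bracket_1_hom_cochain: "lin T \<Longrightarrow> lin X \<Longrightarrow> br 1 T (hom_cochain X) = hb T X"
  using bracket_1[OF algebra_bimodule_axioms, of T X] unfolding hom_cochain_def .

lemma hom_bracket_0: assumes "lin P" shows "hb P 0 = 0" "hb 0 P = 0"
proof -
  interpret P: Vector_Spaces.linear sM sA P by fact
  show "hb P 0 = 0"
    by (rule ext) (auto simp: hom_bracket_def P.zero L1.zero R2.zero split: list.splits)
  then show "hb 0 P = 0" by (simp add: hom_bracket_commute)
qed

text \<open>
  The Jacobi identity for power series, read off at degree \<open>N + 1\<close>. In \<open>[x i, (y * z) m]\<close> with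
  \<open>i + m = N + 1\<close> the second entry vanishes unless \<open>i = 0\<close>, so only the constant terms of the outer
  series survive.
\<close>

lemma conv_bracket_cyclic_sum:
  assumes "\<And>i. lin (x i)" "\<And>i. lin (y i)" "\<And>i. lin (z i)"
    and "\<And>n. n \<le> N \<Longrightarrow> cb y z n = 0" "\<And>n. n \<le> N \<Longrightarrow> cb z x n = 0" "\<And>n. n \<le> N \<Longrightarrow> cb x y n = 0"
  shows "br 2 (x 0) (cb y z (N + 1)) + br 2 (y 0) (cb z x (N + 1)) + br 2 (z 0) (cb x y (N + 1)) = 0"
proof -
  \<comment> \<open>The vanishing terms are put back in order to obtain a sum that is symmetric in \<open>i\<close>, \<open>j\<close>, \<open>k\<close>.\<close>
  have triple: "br 2 (x 0) (cb y z (N + 1)) =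
      (\<Sum>(i, j, k)\<in>{(i, j, k). i + j + k = N + 1}. br 2 (x i) (hb (y j) (z k)))"
    if x: "\<And>i. lin (x i)" and yz: "\<And>n. n \<le> N \<Longrightarrow> cb y z n = 0" for x y z
  proof -
    have "br 2 (x 0) (cb y z (N + 1)) =
        (\<Sum>(i, m)\<in>{(i, m). i + m = N + 1}. br 2 (x i) (cb y z m))"
    proof -
      have "br 2 (x i) (cb y z m) = 0" if "i + m = N + 1" "i \<noteq> 0" for i m
        using that yz[of m] additive.zero[OF additive_bracket[OF x]] by simp
      then have "(\<Sum>(i, m)\<in>{(i, m). i + m = N + 1}. br 2 (x i) (cb y z m)) =
          (\<Sum>(i, m)\<in>{(0, N + 1)}. br 2 (x i) (cb y z m))"
        by (intro sum.mono_neutral_right) (auto simp: finite_antidiagonal)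
      then show ?thesis by simp
    qed
    also have "\<dots> = (\<Sum>(i, m)\<in>{(i, m). i + m = N + 1}. \<Sum>(j, k)\<in>{(j, k). j + k = m}.
        br 2 (x i) (hb (y j) (z k)))"
      by (simp add: conv_bracket_def additive.sum[OF additive_bracket[OF x]] case_prod_beta)
    finally show ?thesis by (simp only: antidiagonal_sum_nested)
  qed
  have "br 2 (x 0) (cb y z (N + 1)) + br 2 (y 0) (cb z x (N + 1)) + br 2 (z 0) (cb x y (N + 1)) =
      (\<Sum>(i, j, k)\<in>{(i, j, k). i + j + k = N + 1}. br 2 (x i) (hb (y j) (z k))) +
      (\<Sum>(i, j, k)\<in>{(i, j, k). i + j + k = N + 1}. br 2 (y j) (hb (z k) (x i))) +
      (\<Sum>(i, j, k)\<in>{(i, j, k). i + j + k = N + 1}. br 2 (z k) (hb (x i) (y j)))"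
    using triple[of x y z] triple[of y z x] triple[of z x y] assms
      triple_sum_rotate[of "\<lambda>i j k. br 2 (y i) (hb (z j) (x k))" "N + 1"]
      triple_sum_rotate[of "\<lambda>k i j. br 2 (z k) (hb (x i) (y j))" "N + 1"]
      triple_sum_rotate[of "\<lambda>i j k. br 2 (z j) (hb (x k) (y i))" "N + 1"]
    by simp
  also have "\<dots> = (\<Sum>(i, j, k)\<in>{(i, j, k). i + j + k = N + 1}.
      br 2 (x i) (hb (y j) (z k)) + br 2 (y j) (hb (z k) (x i)) + br 2 (z k) (hb (x i) (y j)))"
    by (simp add: sum.distrib case_prod_beta)
  also have "\<dots> = 0"
    using assms by (intro sum.neutral) (auto simp only: hom_bracket_jacobi)
  finally show ?thesis .
qed

section \<open>Deformations as vanishing Cauchy products\<close>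

text \<open>
  The equations for \<open>p\<close> and for \<open>q\<close> alone appear doubled in the bracket, and the factor \<open>2\<close> is
  cancelled in characteristic \<open>0\<close>.
\<close>

lemma deformation_iff:
  "deformation sA sM l r T1 T2 N p q \<longleftrightarrow>
     degree p \<le> N \<and> degree q \<le> N \<and> (\<forall>i. lin (coeff p i)) \<and> (\<forall>i. lin (coeff q i)) \<and>
     coeff p 0 = T1 \<and> coeff q 0 = T2 \<and>
     (\<forall>n\<le>N. cb (coeff p) (coeff p) n = 0 \<and> cb (coeff p) (coeff q) n = 0 \<and>
             cb (coeff q) (coeff q) n = 0)"
proof -
  define E where "E S n u v \<longleftrightarrow>
      (\<Sum>(i, j)\<in>{(i, j). i + j = n}. coeff S i u * coeff S j v) =
      (\<Sum>(i, j)\<in>{(i, j). i + j = n}. coeff S i (l (coeff S j u) v + r u (coeff S j v)))"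
    for S :: "('m \<Rightarrow> 'a) poly" and n u v
  define H where "H n u v \<longleftrightarrow>
      (\<Sum>(i, j)\<in>{(i, j). i + j = n}. coeff p i u * coeff q j v + coeff q i u * coeff p j v) =
      (\<Sum>(i, j)\<in>{(i, j). i + j = n}. coeff p i (l (coeff q j u) v + r u (coeff q j v)) +
           coeff q i (l (coeff p j u) v + r u (coeff p j v)))" for n u v
  have "cb (coeff S) (coeff S) n = 0 \<longleftrightarrow> (\<forall>u v. E S n u v)" for S n
    unfolding conv_bracket_eq_0_iff E_def
    by (simp add: sum.distrib case_prod_beta add_self_eq_iff)
  moreover have "cb (coeff p) (coeff q) n = 0 \<longleftrightarrow> (\<forall>u v. H n u v)" for n
    unfolding conv_bracket_eq_0_iff H_def ..
  ultimately have "(\<forall>u v. (\<forall>S\<in>{p, q}. E S n u v) \<and> H n u v) \<longleftrightarrow>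
      cb (coeff p) (coeff p) n = 0 \<and> cb (coeff p) (coeff q) n = 0 \<and>
      cb (coeff q) (coeff q) n = 0" for n
    by auto
  then show ?thesis
    unfolding deformation_def E_def[symmetric] H_def[symmetric] by simp
qed

text \<open>
  A new coefficient at \<open>N + 1\<close> can only meet the constant coefficient of the other series.
\<close>

lemma conv_bracket_extend:
  assumes "lin (x 0)" "lin (y 0)" "x (N + 1) = 0" "y (N + 1) = 0"
  shows "cb (x(N + 1 := X)) (y(N + 1 := Y)) (N + 1) = cb x y (N + 1) + (hb (x 0) Y + hb X (y 0))"
proof -
  let ?S = "{(i, j). i + j = N + 1}" and ?E = "{(0, N + 1), (N + 1, 0)}"
  have split: "cb x' y' (N + 1) =
      hb (x' 0) (y' (N + 1)) + hb (x' (N + 1)) (y' 0) + (\<Sum>(i, j)\<in>?S - ?E. hb (x' i) (y' j))"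
    for x' y'
  proof -
    have "cb x' y' (N + 1) =
        (\<Sum>(i, j)\<in>?S - ?E. hb (x' i) (y' j)) + (\<Sum>(i, j)\<in>?E. hb (x' i) (y' j))"
      unfolding conv_bracket_def
      by (rule sum.subset_diff) (auto simp: finite_antidiagonal)
    then show ?thesis by (simp add: algebra_simps)
  qed
  have "(\<Sum>(i, j)\<in>?S - ?E. hb ((x(N + 1 := X)) i) ((y(N + 1 := Y)) j)) =
      (\<Sum>(i, j)\<in>?S - ?E. hb (x i) (y j))"
    by (rule sum.cong) auto
  then show ?thesis
    unfolding split using assms by (simp add: hom_bracket_0 algebra_simps)
qed

section \<open>Cohomology classes\<close>

lemma hom_bracket_multilinear:
  assumes "lin P" "lin Q"
  shows "hb P Q \<in> multilinear_maps sA sM 2"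
proof -
  interpret P: Vector_Spaces.linear sM sA P by fact
  interpret Q: Vector_Spaces.linear sM sA Q by fact
  have "lin (\<lambda>x. hb P Q (us[i := x]))" if us: "length us = 2" and i: "i < 2" for us i
  proof -
    obtain u v where us: "us = [u, v]" using us by (auto simp: length_Suc_conv numeral_2_eq_2)
    have i: "i = 0 \<or> i = 1" using i by auto
    show ?thesis unfolding us using i
      by (auto simp: Vector_Spaces.linear_iff A.vector_space_axioms M.vector_space_axioms
          hom_bracket_def P.add Q.add P.scale Q.scale L1.add L1.scale L2.add L2.scale
          R1.add R1.scale R2.add R2.scale A.scale_mult_left A.scale_mult_right
          A.scale_right_distrib A.scale_right_diff_distrib algebra_simps)
  qed
  then show ?thesis by (auto simp: multilinear_maps_def hom_bracket_eq_0_if_length)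
qed

interpretation MA: vector_space_pair sM sA ..

lemma multilinear_0: "0 \<in> multilinear_maps sA sM n"
  by (auto simp: multilinear_maps_def MA.linear_zero)

lemma multilinear_add:
  "f \<in> multilinear_maps sA sM n \<Longrightarrow> g \<in> multilinear_maps sA sM n \<Longrightarrow> f + g \<in> multilinear_maps sA sM n"
  by (auto simp: multilinear_maps_def MA.linear_compose_add)

lemma multilinear_diff:
  "f \<in> multilinear_maps sA sM n \<Longrightarrow> g \<in> multilinear_maps sA sM n \<Longrightarrow> f - g \<in> multilinear_maps sA sM n"
  by (auto simp: multilinear_maps_def MA.linear_compose_sub)

lemma multilinear_scale:
  "f \<in> multilinear_maps sA sM n \<Longrightarrow> (\<lambda>us. sA c (f us)) \<in> multilinear_maps sA sM n"
  by (auto simp: multilinear_maps_def MA.linear_compose_scale_right)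

lemma multilinear_sum:
  "(\<And>a. a \<in> S \<Longrightarrow> f a \<in> multilinear_maps sA sM n) \<Longrightarrow> sum f S \<in> multilinear_maps sA sM n"
  by (induction S rule: infinite_finite_induct) (auto simp: multilinear_0 multilinear_add)

lemma conv_bracket_multilinear:
  assumes "\<And>i. lin (x i)" "\<And>i. lin (y i)"
  shows "cb x y n \<in> multilinear_maps sA sM 2"
  unfolding conv_bracket_def using assms
  by (intro multilinear_sum) (auto intro: hom_bracket_multilinear)

lemma additive_differential:
  assumes "lin T1" "lin T2"
  shows "additive (differential sA l r T1 T2 n)"
  by (standard, intro ext)
    (simp add: differential_def additive.add[OF additive_bracket[OF assms(1)]]
       additive.add[OF additive_bracket[OF assms(2)]] algebra_simps)

lemma cochains_0: "0 \<in> cochains sA sM n"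
  by (auto simp: cochains_def multilinear_0)

lemma cochains_diff:
  "F \<in> cochains sA sM n \<Longrightarrow> G \<in> cochains sA sM n \<Longrightarrow> F - G \<in> cochains sA sM n"
  by (auto simp: cochains_def multilinear_diff)

context
  fixes T1 T2 assumes T: "lin T1" "lin T2"
begin

lemma cocycles_0: "0 \<in> cocycles sA sM l r T1 T2 n"
  by (simp add: cocycles_def cochains_0 additive.zero[OF additive_differential[OF T]])

lemma coboundaries_0: "0 \<in> coboundaries sA sM l r T1 T2 n"
  using image_eqI[where f = "differential sA l r T1 T2 (n - 1)", OF _ cochains_0]
    additive.zero[OF additive_differential[OF T]]
  by (simp add: coboundaries_def)

lemma coboundaries_diff:
  "F \<in> coboundaries sA sM l r T1 T2 n \<Longrightarrow> G \<in> coboundaries sA sM l r T1 T2 n \<Longrightarrow>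
   F - G \<in> coboundaries sA sM l r T1 T2 n"
  using cochains_diff
  by (auto simp: coboundaries_def additive.diff[OF additive_differential[OF T], symmetric]
      split: if_splits)

lemma equiv_cohomologous:
  "equiv (cocycles sA sM l r T1 T2 n) (cohomologous sA sM l r T1 T2 n)"
proof (rule equivI)
  show "cohomologous sA sM l r T1 T2 n \<subseteq> cocycles sA sM l r T1 T2 n \<times> cocycles sA sM l r T1 T2 n"
    by (auto simp: cohomologous_def)
  show "refl_on (cocycles sA sM l r T1 T2 n) (cohomologous sA sM l r T1 T2 n)"
    by (auto simp: refl_on_def cohomologous_def coboundaries_0)
  show "sym (cohomologous sA sM l r T1 T2 n)"
  proof (rule symI)
    fix F G assume "(F, G) \<in> cohomologous sA sM l r T1 T2 n"
    then show "(G, F) \<in> cohomologous sA sM l r T1 T2 n"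
      using coboundaries_diff[OF coboundaries_0, of "F - G" n] by (auto simp: cohomologous_def)
  qed
  show "trans (cohomologous sA sM l r T1 T2 n)"
  proof (rule transI)
    fix F G H assume FG: "(F, G) \<in> cohomologous sA sM l r T1 T2 n"
      and GH: "(G, H) \<in> cohomologous sA sM l r T1 T2 n"
    have "G - H \<in> coboundaries sA sM l r T1 T2 n" using GH by (auto simp: cohomologous_def)
    then have "0 - (G - H) \<in> coboundaries sA sM l r T1 T2 n"
      by (rule coboundaries_diff[OF coboundaries_0])
    then have "(F - G) - (0 - (G - H)) \<in> coboundaries sA sM l r T1 T2 n"
      using FG by (intro coboundaries_diff[of "F - G"]) (simp_all add: cohomologous_def)
    moreover have "(F - G) - (0 - (G - H)) = F - H" by (simp add: algebra_simps)
    ultimately show "(F, H) \<in> cohomologous sA sM l r T1 T2 n"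
      using FG GH by (simp add: cohomologous_def)
  qed
qed

lemma cohomology_class_mem:
  "F \<in> cocycles sA sM l r T1 T2 n \<Longrightarrow>
   cohomology_class sA sM l r T1 T2 n F \<in> cohomology sA sM l r T1 T2 n"
  unfolding cohomology_def cohomology_class_def by (rule quotientI)

lemma cohomology_class_eq_0_iff:
  assumes "F \<in> cocycles sA sM l r T1 T2 n"
  shows "cohomology_class sA sM l r T1 T2 n F = cohomology_class sA sM l r T1 T2 n 0 \<longleftrightarrow>
    F \<in> coboundaries sA sM l r T1 T2 n"
  unfolding cohomology_class_def eq_equiv_class_iff[OF equiv_cohomologous assms cocycles_0]
  using assms cocycles_0 by (simp add: cohomologous_def)

text \<open>
  A \<open>1\<close>-cochain is a pair of linear maps \<open>X\<close>, \<open>Y\<close>, and in degree \<open>1\<close> the general bracket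
  is \<open>hom_bracket\<close>.
\<close>

lemma coboundaries_2_iff:
  "F \<in> coboundaries sA sM l r T1 T2 2 \<longleftrightarrow>
   (\<exists>X Y. lin X \<and> lin Y \<and> F 1 = hb T1 X \<and> F 2 = hb T1 Y + hb T2 X \<and> F 3 = hb T2 Y \<and>
     (\<forall>i. i \<notin> {1, 2, 3} \<longrightarrow> F i = 0))"
proof -
  have zero: "br 1 T1 0 = 0" "br 1 T2 0 = 0"
    by (simp_all add: additive.zero[OF additive_bracket] T)
  have d: "differential sA l r T1 T2 1 G = F \<longleftrightarrow>
      F 1 = hb T1 X \<and> F 2 = hb T1 Y + hb T2 X \<and> F 3 = hb T2 Y \<and> (\<forall>i. i \<notin> {1, 2, 3} \<longrightarrow> F i = 0)"
    if "lin X" "lin Y" "G 0 = 0" "G 1 = hom_cochain X" "G 2 = hom_cochain Y" "G 3 = 0" for X Y G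
  proof -
    have "differential sA l r T1 T2 1 G i =
        (if i \<in> {1, 2, 3} then br 1 T1 (G i) + br 1 T2 (G (i - 1)) else 0)" for i
      by (rule ext) (auto simp: differential_def)
    then have "differential sA l r T1 T2 1 G = F \<longleftrightarrow>
        (\<forall>i. (if i \<in> {1, 2, 3} then br 1 T1 (G i) + br 1 T2 (G (i - 1)) else 0) = F i)"
      by (simp only: fun_eq_iff[of "differential sA l r T1 T2 1 G" F])
    also have "\<dots> \<longleftrightarrow> F 1 = hb T1 X \<and> F 2 = hb T1 Y + hb T2 X \<and> F 3 = hb T2 Y \<and>
        (\<forall>i. i \<notin> {1, 2, 3} \<longrightarrow> F i = 0)"
      using that bracket_1_hom_cochain T zero by (auto simp: numeral_2_eq_2 numeral_3_eq_3)
    finally show ?thesis .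
  qed
  have e: "hom_cochain X \<in> multilinear_maps sA sM 1" if "lin X" for X
    using that by (auto simp: multilinear_maps_def hom_cochain_def length_Suc_conv split: list.splits)
  have inv: "\<exists>X. lin X \<and> f = hom_cochain X" if f: "f \<in> multilinear_maps sA sM 1" for f
  proof (intro exI conjI)
    \<comment> \<open>The entry of the list \<open>[0]\<close> is overwritten, so its value is arbitrary.\<close>
    show "lin (\<lambda>u. f [u])"
      using f[unfolded multilinear_maps_def, simplified, THEN conjunct2, rule_format, of "[0]"] by simp
    show "f = hom_cochain (\<lambda>u. f [u])"
      using f by (intro ext) (auto simp: multilinear_maps_def hom_cochain_def split: list.splits)
  qed
  have two: "{1..1 + 1::nat} = {1, 2}" by auto
  show ?thesis
  proof
    assume "F \<in> coboundaries sA sM l r T1 T2 2"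
    then obtain G where G: "G \<in> cochains sA sM 1" "differential sA l r T1 T2 1 G = F"
      by (auto simp: coboundaries_def)
    then have "G 0 = 0" "G 3 = 0" "G 1 \<in> multilinear_maps sA sM 1" "G 2 \<in> multilinear_maps sA sM 1"
      by (auto simp: cochains_def two)
    then show "\<exists>X Y. lin X \<and> lin Y \<and> F 1 = hb T1 X \<and> F 2 = hb T1 Y + hb T2 X \<and> F 3 = hb T2 Y \<and>
     (\<forall>i. i \<notin> {1, 2, 3} \<longrightarrow> F i = 0)"
      using inv d G(2) by metis
  next
    assume "\<exists>X Y. lin X \<and> lin Y \<and> F 1 = hb T1 X \<and> F 2 = hb T1 Y + hb T2 X \<and> F 3 = hb T2 Y \<and>
     (\<forall>i. i \<notin> {1, 2, 3} \<longrightarrow> F i = 0)"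
    then obtain X Y where XY: "lin X" "lin Y" and F: "F 1 = hb T1 X \<and> F 2 = hb T1 Y + hb T2 X \<and>
      F 3 = hb T2 Y \<and> (\<forall>i. i \<notin> {1, 2, 3} \<longrightarrow> F i = 0)" by blast
    define G :: "nat \<Rightarrow> 'm list \<Rightarrow> 'a" where "G = (\<lambda>_. 0)(1 := hom_cochain X, 2 := hom_cochain Y)"
    have "differential sA l r T1 T2 1 G = F"
      using d[OF XY, of G] F by (simp add: G_def)
    moreover have "G \<in> cochains sA sM 1"
      unfolding cochains_def two using e XY by (auto simp: G_def)
    ultimately show "F \<in> coboundaries sA sM l r T1 T2 2" by (auto simp: coboundaries_def)
  qed
qed

end

section \<open>The obstruction of a deformation\<close>

definition neg_half :: "('m list \<Rightarrow> 'a) \<Rightarrow> 'm list \<Rightarrow> 'a" where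
  "neg_half f = (\<lambda>us. sA (- (1 / 2)) (f us))"

lemma neg_half_scalar: "sA (- (1 / 2)) a + sA (- (1 / 2)) a = - a"
proof -
  have "sA (- (1 / 2)) a + sA (- (1 / 2)) a = sA (- (1 / 2) + - (1 / 2)) a"
    by (rule A.scale_left_distrib[symmetric])
  then show ?thesis by simp
qed

lemma neg_half_double: "neg_half f + neg_half f = - f"
  using neg_half_scalar by (intro ext) (simp add: neg_half_def)

lemma double_eq_0: "f = 0" if "f + f = 0" for f :: "'m list \<Rightarrow> 'a"
  using that add_self_eq_iff[of _ 0] by (auto simp: fun_eq_iff)

lemma triple_eq_0: "f = 0" if "f + f + f = 0" for f :: "'m list \<Rightarrow> 'a"
proof
  fix us
  have "sA 3 (f us) = sA (1 + 1 + 1) (f us)" by simp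
  also have "\<dots> = f us + f us + f us" unfolding A.scale_left_distrib A.scale_one ..
  also have "\<dots> = 0" using that by (metis plus_fun_apply zero_fun_apply)
  finally show "f us = 0 us" by simp
qed

lemma double_sum_eq_0:
  fixes x f g :: "'m list \<Rightarrow> 'a"
  assumes "x + x = - f" "g + g + f = 0"
  shows "- g + x + (- g + x) = 0" "x + - g + (x + - g) = 0"
proof -
  have "- g + x + (- g + x) = (x + x) - (g + g)" by (simp add: algebra_simps)
  also have "\<dots> = - (g + g + f)" unfolding assms(1) by (simp add: algebra_simps)
  finally show "- g + x + (- g + x) = 0" using assms(2) by simp
  then show "x + - g + (x + - g) = 0" by (simp only: add.commute[of x])
qed

context
  fixes T1 T2 N p q
  assumes d: "deformation sA sM l r T1 T2 N p q"
begin

abbreviation (input) "P \<equiv> coeff p"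
abbreviation (input) "Q \<equiv> coeff q"
abbreviation (input) "Ob \<equiv> obstruction sA l r N p q"

lemma deformation_linear: "lin (P i)" "lin (Q i)"
  using d by (simp_all add: deformation_iff)

lemma deformation_base_linear: "lin T1" "lin T2"
  using d by (auto simp: deformation_iff)

lemma deformation_constant: "P 0 = T1" "Q 0 = T2"
  using d by (simp_all add: deformation_iff)

lemma deformation_vanish:
  "n \<le> N \<Longrightarrow> cb P P n = 0" "n \<le> N \<Longrightarrow> cb P Q n = 0" "n \<le> N \<Longrightarrow> cb Q Q n = 0"
  using d by (simp_all add: deformation_iff)

lemma deformation_top: "P (N + 1) = 0" "Q (N + 1) = 0"
  using d by (simp_all add: deformation_iff coeff_eq_0)

text \<open>
  The condition \<open>i, j \<ge> 1\<close> in the sum may be dropped because the coefficients at \<open>N + 1\<close> are zero.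
  The middle component needs no factor \<open>1/2\<close>: it is the sum of \<open>p * q\<close> and the equal \<open>q * p\<close>.
\<close>

lemma obstruction_components:
  shows "Ob 1 = neg_half (cb P P (N + 1))"
    and "Ob 2 = - cb P Q (N + 1)"
    and "Ob 3 = neg_half (cb Q Q (N + 1))"
    and "k \<notin> {1, 2, 3} \<Longrightarrow> Ob k = 0"
proof -
  note lin = deformation_linear and top = deformation_top
  have inner: "(\<Sum>(i, j)\<in>{(i, j). i + j = N + 1 \<and> 1 \<le> i \<and> 1 \<le> j}. hb (x i) (y j)) = cb x y (N + 1)"
    if "lin (x 0)" "lin (y 0)" "x (N + 1) = 0" "y (N + 1) = 0" for x y
    unfolding conv_bracket_def
  proof (rule sum.mono_neutral_left)
    show "\<forall>i\<in>{(i, j). i + j = N + 1} - {(i, j). i + j = N + 1 \<and> 1 \<le> i \<and> 1 \<le> j}.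
      (case i of (i, j) \<Rightarrow> hb (x i) (y j)) = 0"
    proof
      fix z assume "z \<in> {(i, j). i + j = N + 1} - {(i, j). i + j = N + 1 \<and> 1 \<le> i \<and> 1 \<le> j}"
      then have "z = (0, N + 1) \<or> z = (N + 1, 0)" by (cases z) auto
      then show "(case z of (i, j) \<Rightarrow> hb (x i) (y j)) = 0" using that by (auto simp: hom_bracket_0)
    qed
  qed (auto simp: finite_antidiagonal)
  note inner = inner[of P P, OF lin(1) lin(1) top(1) top(1)]
    inner[of P Q, OF lin(1) lin(2) top(1) top(2)]
    inner[of Q P, OF lin(2) lin(1) top(2) top(1)]
    inner[of Q Q, OF lin(2) lin(2) top(2) top(2)]

  show "Ob 1 = neg_half (cb P P (N + 1))"
    by (intro ext) (simp add: obstruction_def double_bracket_def neg_half_def inner[symmetric] sum_fun_eval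
        case_prod_beta del: One_nat_def)
  show "Ob 3 = neg_half (cb Q Q (N + 1))"
    by (intro ext) (simp add: obstruction_def double_bracket_def neg_half_def inner[symmetric] sum_fun_eval
        case_prod_beta del: One_nat_def)
  show "Ob 2 = - cb P Q (N + 1)"
  proof
    fix us
    have "Ob 2 us = sA (- (1 / 2)) (cb P Q (N + 1) us + cb Q P (N + 1) us)"
      by (simp add: obstruction_def double_bracket_def inner[symmetric] sum_fun_eval case_prod_beta
          sum.distrib del: One_nat_def)
    then show "Ob 2 us = (- cb P Q (N + 1)) us"
      using neg_half_scalar by (simp add: conv_bracket_commute[of l r Q P] A.scale_right_distrib)
  qed
  show "Ob k = 0" if "k \<notin> {1, 2, 3}"
    using that by (intro ext) (simp add: obstruction_def double_bracket_def case_prod_beta)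
qed

text \<open>
  Up to a nonzero rational factor, the \<open>k\<close>-th component of the cocycle condition is the sum in
  \<open>conv_bracket_cyclic_sum\<close> for three series of which \<open>k - 1\<close> are \<open>q\<close> and the others are \<open>p\<close>. To keep the factors
  \<open>1/2\<close> out of the calculation, each component is shown to vanish after doubling.
\<close>

lemma obstruction_cocycle: "Ob \<in> cocycles sA sM l r T1 T2 2"
proof -
  note O = obstruction_components
  note lin = deformation_linear and vanish = deformation_vanish
  have "Ob \<in> cochains sA sM 2"
  proof -
    have "Ob 1 \<in> multilinear_maps sA sM 2" "Ob 3 \<in> multilinear_maps sA sM 2"
      unfolding O(1,3) neg_half_def
        by (intro multilinear_scale conv_bracket_multilinear lin)+
    moreover have "Ob 2 \<in> multilinear_maps sA sM 2"
      using multilinear_diff[OF multilinear_0 conv_bracket_multilinear[of P Q "N + 1"]] lin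
      unfolding O(2) by simp
    moreover have "{1..2 + 1::nat} = {1, 2, 3}" by auto
    ultimately show ?thesis using O(4) unfolding cochains_def by auto
  qed
  moreover have "differential sA l r T1 T2 2 Ob = 0"
  proof -
    interpret B1: additive "br 2 T1" by (rule additive_bracket[OF deformation_base_linear(1)])
    interpret B2: additive "br 2 T2" by (rule additive_bracket[OF deformation_base_linear(2)])
    \<comment> \<open>The Jacobi identity for \<open>(p, p, p)\<close>, \<open>(p, p, q)\<close>, \<open>(q, q, p)\<close> and \<open>(q, q, q)\<close>;
      equal arguments produce the multiplicities \<open>3\<close> and \<open>2\<close>.\<close>
    let ?F = "cb P P (N + 1)" and ?G = "cb P Q (N + 1)" and ?H = "cb Q Q (N + 1)"
    have van': "\<And>n. n \<le> N \<Longrightarrow> cb Q P n = 0"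
      using vanish(2) by (simp add: conv_bracket_commute[of l r Q P])
    have c1: "br 2 T1 ?F = 0"
      using conv_bracket_cyclic_sum[of P P P N,
          OF lin(1) lin(1) lin(1) vanish(1) vanish(1) vanish(1)]
        deformation_constant
      by - (rule triple_eq_0, simp)
    have c2: "br 2 T1 ?G + br 2 T1 ?G + br 2 T2 ?F = 0"
      using conv_bracket_cyclic_sum[of P P Q N,
          OF lin(1) lin(1) lin(2) vanish(2) van' vanish(1)]
        deformation_constant
      by (simp add: conv_bracket_commute[of l r Q P])
    have c3: "br 2 T2 ?G + br 2 T2 ?G + br 2 T1 ?H = 0"
      using conv_bracket_cyclic_sum[of Q Q P N,
          OF lin(2) lin(2) lin(1) van' vanish(2) vanish(3)]
        deformation_constant
      by (simp add: conv_bracket_commute[of l r Q P])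
    have c4: "br 2 T2 ?H = 0"
      using conv_bracket_cyclic_sum[of Q Q Q N,
          OF lin(2) lin(2) lin(2) vanish(3) vanish(3) vanish(3)]
        deformation_constant
      by - (rule triple_eq_0, simp)
    have "br 2 T1 (Ob 1) = 0"
      by (rule double_eq_0) (simp only: O(1) B1.add[symmetric] neg_half_double B1.minus c1 minus_zero)
    moreover have "br 2 T1 (Ob 2) + br 2 T2 (Ob 1) = 0"
    proof (rule double_eq_0)
      have "br 2 T2 (Ob 1) + br 2 T2 (Ob 1) = - br 2 T2 ?F"
        by (simp only: O(1) B2.add[symmetric] neg_half_double B2.minus)
      then show "br 2 T1 (Ob 2) + br 2 T2 (Ob 1) + (br 2 T1 (Ob 2) + br 2 T2 (Ob 1)) = 0"
        unfolding O(2) B1.minus using c2 by (rule double_sum_eq_0(1))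
    qed
    moreover have "br 2 T1 (Ob 3) + br 2 T2 (Ob 2) = 0"
    proof (rule double_eq_0)
      have "br 2 T1 (Ob 3) + br 2 T1 (Ob 3) = - br 2 T1 ?H"
        by (simp only: O(3) B1.add[symmetric] neg_half_double B1.minus)
      then show "br 2 T1 (Ob 3) + br 2 T2 (Ob 2) + (br 2 T1 (Ob 3) + br 2 T2 (Ob 2)) = 0"
        unfolding O(2) B2.minus using c3 by (rule double_sum_eq_0(2))
    qed
    moreover have "br 2 T2 (Ob 3) = 0"
      by (rule double_eq_0) (simp only: O(3) B2.add[symmetric] neg_half_double B2.minus c4 minus_zero)
    moreover have "differential sA l r T1 T2 2 Ob k =
        (if k \<in> {1, 2, 3, 4} then br 2 T1 (Ob k) + br 2 T2 (Ob (k - 1)) else 0)" for k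
    proof -
      have "k \<in> {1..2 + 2} \<longleftrightarrow> k \<in> {1, 2, 3, 4}" by auto
      then show ?thesis by (intro ext) (simp only: differential_def split: if_split)
    qed
    moreover have "br 2 T1 (Ob 4) = 0" "br 2 T2 (Ob 0) = 0"
      using O(4)[of 4] O(4)[of 0] B1.zero B2.zero by simp_all
    moreover have "(4::nat) - 1 = 3" "(3::nat) - 1 = 2" "(2::nat) - 1 = 1" "(1::nat) - 1 = 0"
      by simp_all
    moreover have "k = 1 \<or> k = 2 \<or> k = 3 \<or> k = 4 \<or> k \<notin> {1, 2, 3, 4}" for k :: nat
      by auto
    ultimately have "differential sA l r T1 T2 2 Ob k = 0" for k
      by (metis add_0_left add_0_right)
    then show ?thesis by (intro ext) simp
  qed
  ultimately show ?thesis
    by (simp add: cocycles_def)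
qed

text \<open>
  The equations of degree at most \<open>N\<close> do not see the new coefficients, so only the three
  equations of degree \<open>N + 1\<close> remain.
\<close>

lemma extension_iff:
  assumes XY: "lin X" "lin Y"
  shows "deformation sA sM l r T1 T2 (N + 1) (p + monom X (N + 1)) (q + monom Y (N + 1)) \<longleftrightarrow>
      Ob 1 = hb T1 X \<and> Ob 2 = hb T1 Y + hb T2 X \<and> Ob 3 = hb T2 Y"
proof -
  note lin = deformation_linear and top = deformation_top
  let ?P' = "P(N + 1 := X)" and ?Q' = "Q(N + 1 := Y)"
  have coeffs: "coeff (p + monom X (N + 1)) = ?P'" "coeff (q + monom Y (N + 1)) = ?Q'"
    using deformation_top by (auto simp: fun_eq_iff coeff_add)
  have low: "cb ?P' ?P' n = cb P P n" "cb ?P' ?Q' n = cb P Q n" "cb ?Q' ?Q' n = cb Q Q n"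
    if "n \<le> N" for n
    using that unfolding conv_bracket_def by (auto intro!: sum.cong)
  have degs: "degree (p + monom X (N + 1)) \<le> N + 1" "degree (q + monom Y (N + 1)) \<le> N + 1"
    using d degree_monom_le[of X "N + 1"] degree_monom_le[of Y "N + 1"]
    by (auto simp: deformation_iff intro!: degree_add_le)
  have "deformation sA sM l r T1 T2 (N + 1) (p + monom X (N + 1)) (q + monom Y (N + 1)) \<longleftrightarrow>
    (\<forall>n\<le>N + 1. cb ?P' ?P' n = 0 \<and> cb ?P' ?Q' n = 0 \<and> cb ?Q' ?Q' n = 0)"
    unfolding deformation_iff coeffs using degs deformation_linear XY deformation_constant by simp
  also have "\<dots> \<longleftrightarrow>
    cb ?P' ?P' (N + 1) = 0 \<and> cb ?P' ?Q' (N + 1) = 0 \<and> cb ?Q' ?Q' (N + 1) = 0"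
    using low deformation_vanish by (auto simp: le_Suc_eq)
  also have "\<dots> \<longleftrightarrow> cb P P (N + 1) + (hb T1 X + hb T1 X) = 0 \<and>
      cb P Q (N + 1) + (hb T1 Y + hb T2 X) = 0 \<and> cb Q Q (N + 1) + (hb T2 Y + hb T2 Y) = 0"
    using conv_bracket_extend[of P P N X X, OF lin(1) lin(1) top(1) top(1)]
      conv_bracket_extend[of P Q N X Y, OF lin(1) lin(2) top(1) top(2)]
      conv_bracket_extend[of Q Q N Y Y, OF lin(2) lin(2) top(2) top(2)]
    by (simp only: deformation_constant hom_bracket_commute[of l r X] hom_bracket_commute[of l r Y])
  also have "\<dots> \<longleftrightarrow> Ob 1 = hb T1 X \<and> Ob 2 = hb T1 Y + hb T2 X \<and> Ob 3 = hb T2 Y"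
  proof -
    have "f + (g + g) = 0 \<longleftrightarrow> neg_half f = g" for f g
    proof -
      have "f + (g + g) = 0 \<longleftrightarrow> neg_half f + neg_half f = g + g"
        unfolding neg_half_double by (metis add.commute add.inverse_inverse eq_neg_iff_add_eq_0)
      also have "\<dots> \<longleftrightarrow> neg_half f = g" by (simp add: fun_eq_iff add_self_eq_iff)
      finally show ?thesis .
    qed
    moreover have "f + g = 0 \<longleftrightarrow> - f = g" for f g :: "'m list \<Rightarrow> 'a"
      by (metis add.commute eq_neg_iff_add_eq_0)
    ultimately show ?thesis unfolding obstruction_components(1-3) by simp
  qed
  finally show ?thesis .
qed

lemma extensible_iff_coboundary:
  "extensible sA sM l r T1 T2 N p q \<longleftrightarrow> Ob \<in> coboundaries sA sM l r T1 T2 2"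
  unfolding extensible_def coboundaries_2_iff[OF deformation_base_linear]
  using extension_iff obstruction_components(4) by blast

end

end

theorem theorem4p10:
  fixes sA :: "'k::field_char_0 \<Rightarrow> 'a::ring \<Rightarrow> 'a"
    and sM :: "'k \<Rightarrow> 'm::ab_group_add \<Rightarrow> 'm"
    and l :: "'a \<Rightarrow> 'm \<Rightarrow> 'm" and r :: "'m \<Rightarrow> 'a \<Rightarrow> 'm"
    and T1 T2 :: "'m \<Rightarrow> 'a"
    and N :: nat
    and p q :: "('m \<Rightarrow> 'a) poly"
  assumes "algebra_bimodule sA sM l r"
    and "compatible_O_operator sA sM l r T1 T2"
    and "deformation sA sM l r T1 T2 N p q"
  shows "cohomology_class sA sM l r T1 T2 2 (obstruction sA l r N p q)
           \<in> cohomology sA sM l r T1 T2 2 \<and>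
         (extensible sA sM l r T1 T2 N p q \<longleftrightarrow>
          cohomology_class sA sM l r T1 T2 2 (obstruction sA l r N p q) =
          cohomology_class sA sM l r T1 T2 2 0)"
proof -
  interpret algebra_bimodule sA sM l r by fact
  note d = assms(3)
  note linear = deformation_base_linear[OF d]
  show ?thesis
    using obstruction_cocycle[OF d] cohomology_class_mem[OF linear]
      cohomology_class_eq_0_iff[OF linear] extensible_iff_coboundary[OF d]
    by blast
qed

end
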